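(* Let $A\in\mathbb{C}^{n\times n}$, $\varepsilon>0$, $\delta>0$, and let $\mathcal{S}\subset\mathbb{C}^{n\times n}$ be a complex-linear or real-linear subspace. Let $(E_\star,E_\star^{\mathcal{S}})\in\mathbb{C}^{n\times n}\times\mathcal{S}$ with $\|E_\star\|_F=\|E_\star^{\mathcal{S}}\|_F=1$ be a minimizer of $$F_{\varepsilon,\delta}(E,E^{\mathcal{S}})=-\mathrm{Re}\,\lambda(A+\varepsilon E+\delta E^{\mathcal{S}})$$ over all $(E,E^{\mathcal{S}})\in\mathbb{C}^{n\times n}\times\mathcal{S}$ with $\|E\|_F=\|E^{\mathcal{S}}\|_F=1$. Assume that (i) the rightmost eigenvalue $\lambda(A+\varepsilon E+\delta E^{\mathcal{S}})$ is simple at $(E_\star,E_\star^{\mathcal{S}})$ and depends continuously on $(E,E^{\mathcal{S}})$ in a neighborhood of $(E_\star,E_\star^{\mathcal{S}})$; (ii) $\Pi^{\mathcal{S}}G_\star\neq0$, where $G_\star=-x_\star y_\star^*$ and $x_\star,y_\star$ are left and right eigenvectors of $A+\varepsilon E_\star+\delta E_\star^{\mathcal{S}}$ to the rightmost eigenvalue, of unit norm and with $x_\star^*y_\star>0$. Then $E_\star$ is of rank 1, and $$E_\star^{\mathcal{S}}=\pm\,\eta\,\Pi^{\mathcal{S}}E_\star\quad\text{with}\quad \eta=1/\|\Pi^{\mathcal{S}}E_\star\|_F .$$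
   Context: For a square matrix $M$, $\lambda(M)$ denotes an eigenvalue of $M$ of maximal real part ("rightmost eigenvalue"; in case of several such eigenvalues, e.g. the one with maximal imaginary part). A left eigenvector $x$ satisfies $x^*M=\lambda x^*$, a right eigenvector $y$ satisfies $My=\lambda y$. $\langle X,Y\rangle=\mathrm{trace}(X^*Y)$ is the inner product on $\mathbb{C}^{n\times n}$ inducing the Frobenius norm $\|\cdot\|_F$. $\Pi^{\mathcal{S}}:\mathbb{C}^{n\times n}\to\mathcal{S}$ is the orthogonal projection onto $\mathcal{S}$ with respect to the real inner product: $\Pi^{\mathcal{S}}Z\in\mathcal{S}$ and $\mathrm{Re}\langle\Pi^{\mathcal{S}}Z,W\rangle=\mathrm{Re}\langle Z,W\rangle$ for all $W\in\mathcal{S}$. *)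

theory Defs
  imports "HOL-Analysis.Analysis" "HOL-Computational_Algebra.Polynomial"
begin

definition conj_transpose :: "complex^'n^'m \<Rightarrow> complex^'m^'n" where
  "conj_transpose X = (\<chi> i j. cnj (X $ j $ i))"

definition conj_vec :: "complex^'n \<Rightarrow> complex^'n" where
  "conj_vec x = (\<chi> i. cnj (x $ i))"

text \<open>The scalar \<open>x\<^sup>* y\<close>, conjugate-linear in the first argument.\<close>
definition cdot :: "complex^'n \<Rightarrow> complex^'n \<Rightarrow> complex" where
  "cdot x y = (\<Sum>i\<in>UNIV. cnj (x $ i) * y $ i)"

text \<open>The matrix \<open>x y\<^sup>*\<close>.\<close>
definition outer :: "complex^'m \<Rightarrow> complex^'n \<Rightarrow> complex^'n^'m" where
  "outer x y = (\<chi> i j. x $ i * cnj (y $ j))"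

definition frob_inner :: "complex^'n^'n \<Rightarrow> complex^'n^'n \<Rightarrow> complex" where
  "frob_inner X Y = trace (conj_transpose X ** Y)"

lemma Re_frob_inner: "Re (frob_inner X Y) = X \<bullet> Y"
proof -
  have "Re (frob_inner X Y) = (\<Sum>i\<in>UNIV. \<Sum>k\<in>UNIV. X $ k $ i \<bullet> Y $ k $ i)"
    by (simp add: frob_inner_def trace_def conj_transpose_def matrix_matrix_mult_def
        inner_complex_def)
  also have "\<dots> = X \<bullet> Y"
    by (subst sum.swap) (simp add: inner_vec_def)
  finally show ?thesis .
qed

text \<open>The library norm on \<^typ>\<open>complex^'n^'n\<close> is the Frobenius norm.\<close>
lemma norm_eq_frobenius: "norm X = sqrt (Re (frob_inner X X))"
  by (simp add: Re_frob_inner norm_eq_sqrt_inner)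

definition eigenvalue :: "complex^'n^'n \<Rightarrow> complex \<Rightarrow> bool" where
  "eigenvalue M \<mu> \<longleftrightarrow> (\<exists>v. v \<noteq> 0 \<and> M *v v = \<mu> *s v)"

definition left_eigenvector :: "complex^'n^'n \<Rightarrow> complex \<Rightarrow> complex^'n \<Rightarrow> bool" where
  "left_eigenvector M \<mu> x \<longleftrightarrow> x \<noteq> 0 \<and> conj_vec x v* M = \<mu> *s conj_vec x"

definition right_eigenvector :: "complex^'n^'n \<Rightarrow> complex \<Rightarrow> complex^'n \<Rightarrow> bool" where
  "right_eigenvector M \<mu> y \<longleftrightarrow> y \<noteq> 0 \<and> M *v y = \<mu> *s y"

definition charpoly :: "complex^'n^'n \<Rightarrow> complex poly" where
  "charpoly M = det (\<chi> i j. (if i = j then [:0, 1:] else 0) - [:M $ i $ j:])"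

text \<open>Simple means algebraic multiplicity one.\<close>
definition simple_eigenvalue :: "complex^'n^'n \<Rightarrow> complex \<Rightarrow> bool" where
  "simple_eigenvalue M \<mu> \<longleftrightarrow> eigenvalue M \<mu> \<and> order \<mu> (charpoly M) = 1"

definition rightmost_eigenvalue :: "complex^'n^'n \<Rightarrow> complex \<Rightarrow> bool" where
  "rightmost_eigenvalue M \<mu> \<longleftrightarrow>
     eigenvalue M \<mu> \<and> (\<forall>\<nu>. eigenvalue M \<nu> \<longrightarrow> Re \<nu> \<le> Re \<mu>)"

text \<open>A complex-linear subspace is in particular real-linear, so \<^term>\<open>subspace S\<close>, which is
  real-linearity for sets of complex matrices, covers both kinds of structure spaces.\<close>
definition orth_proj :: "(complex^'n^'n) set \<Rightarrow> complex^'n^'n \<Rightarrow> complex^'n^'n" where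
  "orth_proj S Z =
     (THE P. P \<in> S \<and> (\<forall>W\<in>S. Re (frob_inner P W) = Re (frob_inner Z W)))"

lemma orth_proj_unique_exists:
  fixes S :: "(complex^'n^'n) set"
  assumes "subspace S"
  shows "\<exists>!P. P \<in> S \<and> (\<forall>W\<in>S. Re (frob_inner P W) = Re (frob_inner Z W))"
proof -
  have sp: "span S = S"
    using assms by (simp add: span_eq_iff)
  obtain P Q where P: "P \<in> span S" and Q: "\<And>W. W \<in> span S \<Longrightarrow> orthogonal Q W"
    and Z: "Z = P + Q"
    using orthogonal_subspace_decomp_exists [of S Z] by metis
  show ?thesis
  proof (rule ex1I)
    show "P \<in> S \<and> (\<forall>W\<in>S. Re (frob_inner P W) = Re (frob_inner Z W))"
      using P Q sp by (simp add: Re_frob_inner Z inner_add_left orthogonal_def)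
  next
    fix P'
    assume P': "P' \<in> S \<and> (\<forall>W\<in>S. Re (frob_inner P' W) = Re (frob_inner Z W))"
    have "P' - P \<in> S"
      using P P' sp assms by (simp add: subspace_diff)
    then have "P' \<bullet> (P' - P) = P \<bullet> (P' - P)"
      using P' Q sp by (simp add: Re_frob_inner Z inner_add_left orthogonal_def)
    then have "(P' - P) \<bullet> (P' - P) = 0"
      by (simp add: inner_diff_left)
    then show "P' = P"
      by simp
  qed
qed

definition feasible :: "(complex^'n^'n) set \<Rightarrow> ((complex^'n^'n) \<times> (complex^'n^'n)) set" where
  "feasible S = {(E, ES). ES \<in> S \<and> norm E = 1 \<and> norm ES = 1}"

definition perturbed ::
    "complex^'n^'n \<Rightarrow> real \<Rightarrow> real \<Rightarrow> (complex^'n^'n) \<times> (complex^'n^'n) \<Rightarrow> complex^'n^'n" where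
  "perturbed A \<epsilon> \<delta> = (\<lambda>(E, ES). A + \<epsilon> *\<^sub>R E + \<delta> *\<^sub>R ES)"

text \<open>The argument \<open>lam\<close> is a selection of a rightmost eigenvalue of every matrix.\<close>
definition objective ::
    "(complex^'n^'n \<Rightarrow> complex) \<Rightarrow> complex^'n^'n \<Rightarrow> real \<Rightarrow> real \<Rightarrow>
     (complex^'n^'n) \<times> (complex^'n^'n) \<Rightarrow> real" where
  "objective lam A \<epsilon> \<delta> p = - Re (lam (perturbed A \<epsilon> \<delta> p))"

end

theory Submission
  imports Defs
begin

text \<open>
  Along a curve \<open>M(t)\<close> through the optimal matrix \<open>M\<close>, with continuous rightmost eigenvalue \<open>\<mu>(t)\<close>
  and unit right eigenvectors \<open>v(t)\<close>, the left eigenvector \<open>x\<close> of \<open>M\<close> gives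
  \<open>(\<mu>(t) - \<mu>(0)) x\<^sup>* v(t) = x\<^sup>* (M(t) - M) v(t)\<close>. Since \<open>\<mu>(0)\<close> is simple, every limit
  point of \<open>v(t)\<close> is a multiple of \<open>y\<close>, so the optimality of \<open>M\<close> forces
  \<open>Re \<langle>x y\<^sup>*, M'(0)\<rangle> \<le> 0\<close> without any differentiability result for eigenvectors. Great circles
  through \<open>E_star\<close>, and through \<open>ES_star\<close> inside \<open>S\<close>, then show that \<open>x y\<^sup>*\<close> is a real multiple of
  \<open>E_star\<close> and its projection a real multiple of \<open>ES_star\<close>.
\<close>

section \<open>Characteristic polynomials and eigenvectors of simple eigenvalues\<close>

text \<open>Expand by linearity in row \<open>k\<close>: each term with \<open>j \<noteq> k\<close>
  has equal rows \<open>j\<close> and \<open>k\<close>, so only the term \<open>j = k\<close>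
  survives.\<close>

lemma det_row_combination:
  fixes A :: "'a::comm_ring_1^'n^'n"
  shows "det (\<chi> i. if i = k then (\<Sum>j\<in>UNIV. c j *s A $ j) else A $ i) = c k * det A"
proof -
  have "det (\<chi> i. if i = k then (\<Sum>j\<in>UNIV. c j *s A $ j) else A $ i)
      = (\<Sum>j\<in>UNIV. det (\<chi> i. if i = k then c j *s A $ j else A $ i))"
    by (rule det_linear_row_sum) simp
  also have "\<dots> = (\<Sum>j\<in>UNIV. if j = k then c k * det A else 0)"
  proof (rule sum.cong)
    fix j
    have "det (\<chi> i. if i = k then A $ j else A $ i) = (if j = k then det A else 0)"
    proof (cases "j = k")
      case True
      then have "(\<chi> i. if i = k then A $ j else A $ i) = A"
        by (simp add: vec_eq_iff)
      with True show ?thesis by simp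
    next
      case False
      then show ?thesis
        by (auto simp: row_def intro!: det_identical_rows[where i=j and j=k])
    qed
    then show "det (\<chi> i. if i = k then c j *s A $ j else A $ i) = (if j = k then c k * det A else 0)"
      by (simp add: det_row_mul)
  qed simp
  finally show ?thesis by simp
qed

lemma poly_charpoly: "poly (charpoly M) z = det (mat z - M)"
  by (simp add: charpoly_def det_def poly_sum poly_prod mat_def
      if_distrib [of "\<lambda>p. poly p z"] cong: if_cong)

lemma eigenvalue_iff_det:
  fixes M :: "complex^'n^'n"
  shows "eigenvalue M z \<longleftrightarrow> det (mat z - M) = 0"
proof -
  have "mat z *v v = z *s v" for v :: "complex^'n"
    by (simp add: vec_eq_iff matrix_vector_mult_def mat_def
        if_distrib [of "\<lambda>a. a * _"] cong: if_cong)
  then have "(mat z - M) *v v = 0 \<longleftrightarrow> M *v v = z *s v" for v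
    by (simp add: matrix_vector_mult_diff_rdistrib eq_commute [of "z *s v"])
  then show ?thesis
    by (metis eigenvalue_def invertible_det_nz invertible_left_inverse matrix_left_invertible_ker)
qed

text \<open>A zero characteristic polynomial would make every number an eigenvalue, even one further
  to the right than \<open>\<mu>\<close>. Nonvanishing is what turns the \<open>order\<close> in the
  definition of simplicity into a divisibility statement.\<close>

lemma charpoly_nonzero:
  assumes "rightmost_eigenvalue M \<mu>"
  shows "charpoly M \<noteq> 0"
proof
  assume "charpoly M = 0"
  then have "eigenvalue M (\<mu> + 1)"
    by (metis eigenvalue_iff_det poly_charpoly poly_0)
  with assms have "Re (\<mu> + 1) \<le> Re \<mu>"
    unfolding rightmost_eigenvalue_def by blast
  then show False by simp
qed

text \<open>This is \<open>(z I - M) v = (z - \<mu>) v\<close> over the polynomial ring, written as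
  a combination of the columns of \<open>z I - M\<close> so that it fits
  \<open>det_row_combination\<close> after transposition.\<close>

lemma characteristic_matrix_eigenvector:
  fixes M :: "complex^'n^'n"
  assumes "M *v v = \<mu> *s v"
  shows "(\<Sum>j\<in>UNIV. [:v $ j:] *s (\<chi> i. (if i = j then [:0, 1:] else 0) - [:M $ i $ j:]))
    = [:- \<mu>, 1:] *s (\<chi> i. [:v $ i:])"
proof (subst vec_eq_iff, intro allI)
  fix i
  have "(\<Sum>j\<in>UNIV. [:v $ j:] * ((if i = j then [:0, 1:] else 0) - [:M $ i $ j:]))
      = (\<Sum>j\<in>UNIV. (if i = j then [:0, v $ j:] else 0) - [:M $ i $ j * v $ j:])"
    by (intro sum.cong refl) (simp only: right_diff_distrib, simp add: mult.commute)
  also have "\<dots> = [:0, v $ i:] - [:(M *v v) $ i:]"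
    by (simp add: sum_subtractf matrix_vector_mult_def poly_eq_iff coeff_sum coeff_pCons split: nat.split)
  finally show "(\<Sum>j\<in>UNIV. [:v $ j:] *s (\<chi> i. (if i = j then [:0, 1:] else 0) - [:M $ i $ j:])) $ i
    = ([:- \<mu>, 1:] *s (\<chi> i. [:v $ i:])) $ i"
    by (simp add: assms)
qed

text \<open>Replacing two columns of \<open>z I - M\<close> by its products with \<open>v\<close> and \<open>w\<close> extracts the factor
  \<open>z - \<mu>\<close> twice and changes the determinant only by a nonzero constant; \<open>w $ i = 0\<close> keeps the
  second replacement from involving the column already replaced.\<close>
lemma independent_eigenvectors_imp_square_dvd_charpoly:
  assumes v: "M *v v = \<mu> *s v" and w: "M *v w = \<mu> *s w"
    and i: "v $ i \<noteq> 0" and j: "w $ j \<noteq> 0" and "w $ i = 0"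
  shows "[:- \<mu>, 1:]^2 dvd charpoly M"
proof -
  let ?p = "[:- \<mu>, 1:]"
  have const: "[:c:] * q = smult c q" for c :: complex and q
    by simp
  \<comment> \<open>\<open>B\<close> is the transpose of \<open>z I - M\<close>: eigenvectors
    combine columns, while the determinant lemma combines rows.\<close>
  define B where "B = (\<chi> j i. (if i = j then [:0, 1:] else 0) - [:M $ i $ j:])"
  have B: "B $ j = (\<chi> i. (if i = j then [:0, 1:] else 0) - [:M $ i $ j:])" for j
    by (simp add: B_def)
  have char: "charpoly M = det B"
  proof -
    have "transpose B = (\<chi> i j. (if i = j then [:0, 1:] else 0) - [:M $ i $ j:])"
      by (simp only: B_def transpose_def vec_lambda_beta)
    then show ?thesis
      using det_transpose [of B] by (simp only: charpoly_def)
  qed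
  define B1 where "B1 = (\<chi> k. if k = i then (\<chi> i. [:v $ i:]) else B $ k)"
  have "(\<Sum>k\<in>UNIV. [:v $ k:] *s B $ k) = ?p *s (\<chi> i. [:v $ i:])"
    unfolding B by (rule characteristic_matrix_eigenvector [OF v])
  then have 1: "[:v $ i:] * det B = ?p * det B1"
    using det_row_combination [of i "\<lambda>k. [:v $ k:]" B] by (simp only: det_row_mul B1_def)
  have eq: "(\<Sum>k\<in>UNIV. [:w $ k:] *s B1 $ k) = ?p *s (\<chi> i. [:w $ i:])"
  proof -
    have "(\<Sum>k\<in>UNIV. [:w $ k:] *s B1 $ k) = (\<Sum>k\<in>UNIV. [:w $ k:] *s B $ k)"
      using \<open>w $ i = 0\<close> by (intro sum.cong) (auto simp: B1_def)
    also have "\<dots> = ?p *s (\<chi> i. [:w $ i:])"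
      unfolding B by (rule characteristic_matrix_eigenvector [OF w])
    finally show ?thesis .
  qed
  have "[:w $ j:] * det B1 = ?p * det (\<chi> k. if k = j then (\<chi> i. [:w $ i:]) else B1 $ k)"
    using det_row_combination [of j "\<lambda>k. [:w $ k:]" B1] by (simp only: eq det_row_mul)
  then have "?p dvd [:w $ j:] * det B1" by (simp only: dvd_triv_left)
  then have "?p dvd det B1"
    using j unfolding const by (rule dvd_smult_cancel)
  then have "?p * ?p dvd [:v $ i:] * det B"
    unfolding 1 by (rule mult_dvd_mono [OF dvd_refl])
  then show ?thesis
    using i unfolding const char power2_eq_square by (rule dvd_smult_cancel)
qed

text \<open>Subtract the multiple of \<open>v\<close> that clears coordinate \<open>i\<close> of
  \<open>w\<close>. A nonzero remainder would be a second independent eigenvector and give a double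
  root.\<close>

lemma simple_eigenvalue_eigenvector_unique:
  assumes simple: "simple_eigenvalue M \<mu>" and "charpoly M \<noteq> 0"
    and v: "right_eigenvector M \<mu> v" and w: "M *v w = \<mu> *s w"
  shows "\<exists>c. w = c *s v"
proof -
  from v obtain i where i: "v $ i \<noteq> 0" and v': "M *v v = \<mu> *s v"
    unfolding right_eigenvector_def vec_eq_iff by auto
  define c where "c = w $ i / v $ i"
  have "M *v (w - c *s v) = \<mu> *s (w - c *s v)"
    using v' w by (simp add: matrix_vector_mult_diff_distrib vector_scalar_commute vec.scale_right_diff_distrib mult.commute)
  moreover have "(w - c *s v) $ i = 0"
    using i by (simp add: c_def)
  moreover have "\<not> [:- \<mu>, 1:]^2 dvd charpoly M"
    using assms by (simp add: order_divides simple_eigenvalue_def)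
  ultimately have "(w - c *s v) $ j = 0" for j
    using independent_eigenvectors_imp_square_dvd_charpoly [OF v' _ i] by blast
  then have "w = c *s v"
    by (simp add: vec_eq_iff)
  then show ?thesis by auto
qed

section \<open>Left eigenvectors and the one-sided derivative of an eigenvalue\<close>

text \<open>Up to the positive factor \<open>cdot x y\<close>, this is the real part of the
  eigenvalue derivative \<open>cdot x (D *v y) / cdot x y\<close> in direction
  \<open>D\<close>.\<close>

lemma outer_inner: "outer x y \<bullet> D = Re (cdot x (D *v y))"
  by (simp add: outer_def cdot_def inner_vec_def matrix_vector_mult_def inner_complex_def sum_distrib_left algebra_simps)

lemma cdot_scale_right: "cdot x (c *s y) = c * cdot x y"
  by (simp add: cdot_def sum_distrib_left algebra_simps)

lemma left_eigenvector_cdot: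
  assumes "left_eigenvector M \<mu> x"
  shows "cdot x (M *v v) = \<mu> * cdot x v"
proof -
  have "cdot x (M *v v) = (\<Sum>j\<in>UNIV. (conj_vec x v* M) $ j * v $ j)"
    by (simp add: cdot_def conj_vec_def vector_matrix_mult_def matrix_vector_mult_def
        sum_distrib_left sum_distrib_right mult_ac) (rule sum.swap)
  also have "\<dots> = \<mu> * cdot x v"
    using assms by (simp add: left_eigenvector_def cdot_def conj_vec_def sum_distrib_left mult_ac)
  finally show ?thesis .
qed

lemma tendsto_cdot:
  "(f \<longlongrightarrow> v) F \<Longrightarrow> ((\<lambda>n. cdot x (f n)) \<longlongrightarrow> cdot x v) F"
  unfolding cdot_def by (intro tendsto_intros)

lemma tendsto_matrix_vector_mult:
  fixes A :: "_ \<Rightarrow> complex^'n^'m"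
  assumes "(A \<longlongrightarrow> B) F" "(f \<longlongrightarrow> v) F"
  shows "((\<lambda>n. A n *v f n) \<longlongrightarrow> B *v v) F"
  unfolding matrix_vector_mult_def
  by (intro vec_tendstoI) (simp, intro tendsto_intros assms)

lemma eigenvalue_unit_eigenvector:
  assumes "eigenvalue M \<mu>"
  obtains v where "norm v = 1" "M *v v = \<mu> *s v"
proof -
  from assms obtain u where u: "u \<noteq> 0" "M *v u = \<mu> *s u"
    by (auto simp: eigenvalue_def)
  have eq: "complex_of_real (1 / norm u) *s u = (1 / norm u) *\<^sub>R u"
    by (subst vec_eq_iff) (simp only: vector_smult_component vector_scaleR_component, simp add: scaleR_conv_of_real)
  show thesis
  proof (rule that [of "complex_of_real (1 / norm u) *s u"])
    show "norm (complex_of_real (1 / norm u) *s u) = 1"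
      unfolding eq using u by simp
    show "M *v (complex_of_real (1 / norm u) *s u) = \<mu> *s (complex_of_real (1 / norm u) *s u)"
      using u(2) by (simp add: vector_scalar_commute mult.commute)
  qed
qed

text \<open>The left eigenvector expresses the difference quotient of the eigenvalue through unit
  eigenvectors of \<open>Mn n\<close>. Since only a sign is claimed, convergence of these along a
  subsequence suffices.\<close>

lemma eigenvalue_directional_derivative_nonpos:
  fixes Mn :: "nat \<Rightarrow> complex^'n^'n"
  assumes eig: "\<And>n. eigenvalue (Mn n) (\<mu> n)"
    and \<mu>: "\<mu> \<longlonglongrightarrow> \<nu>" and Mn: "Mn \<longlonglongrightarrow> M"
    and t: "\<And>n. t n > 0"
    and D: "(\<lambda>n. (1 / t n) *\<^sub>R (Mn n - M)) \<longlonglongrightarrow> D"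
    and le: "\<And>n. Re (\<mu> n) \<le> Re \<nu>"
    and x: "left_eigenvector M \<nu> x" and xy: "cdot x y \<in> \<real>" "Re (cdot x y) > 0"
    and uniq: "\<And>v. M *v v = \<nu> *s v \<Longrightarrow> \<exists>c. v = c *s y"
  shows "outer x y \<bullet> D \<le> 0"
proof -
  obtain v where v: "\<And>n. norm (v n) = 1" "\<And>n. Mn n *v v n = \<mu> n *s v n"
  proof -
    have "\<forall>n. \<exists>v. norm v = 1 \<and> Mn n *v v = \<mu> n *s v"
      using eigenvalue_unit_eigenvector [OF eig] by blast
    then show thesis using that by metis
  qed
  have "compact (sphere (0 :: complex^'n) 1)" by simp
  then obtain w r where w: "norm w = 1" and r: "strict_mono r" and lim: "(v \<circ> r) \<longlonglongrightarrow> w"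
    unfolding compact_def using v(1) by (metis dist_0_norm mem_sphere)
  have lim': "(\<lambda>n. v (r n)) \<longlonglongrightarrow> w"
    using lim by (simp add: o_def)
  have sub: "(\<lambda>n. f (r n)) \<longlonglongrightarrow> l" if "f \<longlonglongrightarrow> l" for f :: "nat \<Rightarrow> 'b::topological_space" and l
    using LIMSEQ_subseq_LIMSEQ [OF that r] by (simp add: o_def)
  have "(\<lambda>n. Mn (r n) *v v (r n)) \<longlonglongrightarrow> M *v w"
    by (intro tendsto_matrix_vector_mult sub Mn lim')
  moreover have "(\<lambda>n. \<mu> (r n) *s v (r n)) \<longlonglongrightarrow> \<nu> *s w"
    by (intro vec_tendstoI) (simp, intro tendsto_intros sub \<mu> lim')
  ultimately have "M *v w = \<nu> *s w"
    unfolding v(2) by (rule LIMSEQ_unique)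
  then obtain c where c: "w = c *s y" using uniq by blast
  \<comment> \<open>The limit has norm 1, so it is not zero. Hence
    \<open>cdot x w = c * cdot x y\<close> is nonzero and may serve as a denominator.\<close>
  with w have "c \<noteq> 0" by auto
  have quotient: "(\<mu> n - \<nu>) / of_real (t n) * cdot x (v n) = cdot x (((1 / t n) *\<^sub>R (Mn n - M)) *v v n)" for n
  proof -
    have "((1 / t n) *\<^sub>R (Mn n - M)) *v v n = of_real (1 / t n) *s (Mn n *v v n - M *v v n)"
      unfolding matrix_vector_mult_diff_rdistrib [symmetric]
      by (simp only: vec_eq_iff matrix_vector_mult_def vec_lambda_beta vector_smult_component
          vector_scaleR_component sum_distrib_left, simp add: scaleR_conv_of_real)
    moreover have "cdot x (Mn n *v v n - M *v v n) = (\<mu> n - \<nu>) * cdot x (v n)"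
    proof -
      have "cdot x (a - b) = cdot x a - cdot x b" for a b
        by (simp add: cdot_def algebra_simps sum_subtractf)
      then show ?thesis
        by (simp add: left_eigenvector_cdot [OF x] v(2) cdot_scale_right left_diff_distrib)
    qed
    ultimately show ?thesis
      by (simp only: cdot_scale_right) simp
  qed
  have xw: "(\<lambda>n. cdot x (v (r n))) \<longlonglongrightarrow> c * cdot x y"
    using tendsto_cdot [OF lim', of x] by (simp add: c cdot_scale_right)
  have nz: "c * cdot x y \<noteq> 0" using \<open>c \<noteq> 0\<close> xy by auto
  have "(\<lambda>n. cdot x (((1 / t (r n)) *\<^sub>R (Mn (r n) - M)) *v v (r n))) \<longlonglongrightarrow> c * cdot x (D *v y)"
    using tendsto_cdot [OF tendsto_matrix_vector_mult [OF sub [OF D] lim'], of x]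
    by (simp add: c cdot_scale_right vector_scalar_commute)
  \<comment> \<open>The factor \<open>cdot x (v (r n))\<close> stays on both sides of the fraction
    because it is known to be nonzero only eventually. In the limit the unknown \<open>c\<close>
    cancels.\<close>
  then have "(\<lambda>n. (\<mu> (r n) - \<nu>) / of_real (t (r n)) * cdot x (v (r n)) / cdot x (v (r n)))
      \<longlonglongrightarrow> c * cdot x (D *v y) / (c * cdot x y)"
    unfolding quotient by (rule tendsto_divide [OF _ xw nz])
  moreover have "eventually (\<lambda>n. cdot x (v (r n)) \<noteq> 0) sequentially"
    using tendsto_imp_eventually_ne [OF xw nz] .
  ultimately have "(\<lambda>n. (\<mu> (r n) - \<nu>) / of_real (t (r n))) \<longlonglongrightarrow> cdot x (D *v y) / cdot x y"
    using \<open>c \<noteq> 0\<close> by (auto elim!: Lim_transform_eventually eventually_mono)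
  then have "(\<lambda>n. Re ((\<mu> (r n) - \<nu>) / of_real (t (r n)))) \<longlonglongrightarrow> Re (cdot x (D *v y) / cdot x y)"
    by (rule tendsto_Re)
  moreover have "Re ((\<mu> (r n) - \<nu>) / of_real (t (r n))) \<le> 0" for n
    using le [of "r n"] t [of "r n"] by (simp add: Re_divide_of_real divide_nonpos_pos)
  ultimately have "Re (cdot x (D *v y) / cdot x y) \<le> 0"
    by (intro LIMSEQ_le_const2) auto
  \<comment> \<open>Dividing by a positive real number keeps the sign of the real part.\<close>
  moreover have "cdot x y = of_real (Re (cdot x y))"
    using xy(1) by (simp add: complex_is_Real_iff complex_eq_iff)
  ultimately have "Re (cdot x (D *v y)) / Re (cdot x y) \<le> 0"
    by (metis Re_divide_of_real)
  then show ?thesis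
    using xy(2) by (simp add: outer_inner divide_le_0_iff)
qed

section \<open>Stationarity on unit spheres and great circles\<close>

text \<open>Otherwise the component \<open>W\<close> of \<open>P\<close> orthogonal to
  \<open>E\<close> is nonzero, and its normalization is an admissible \<open>Z\<close> with
  \<open>P \<bullet> Z = norm W > 0\<close>.\<close>

lemma sphere_stationary:
  fixes E P :: "'a::real_inner"
  assumes T: "subspace T" "E \<in> T" "P \<in> T" and E: "norm E = 1"
    and le: "\<And>Z. Z \<in> T \<Longrightarrow> norm Z = 1 \<Longrightarrow> Z \<bullet> E = 0 \<Longrightarrow> P \<bullet> Z \<le> 0"
  shows "P = (P \<bullet> E) *\<^sub>R E"
proof (rule ccontr)
  define W where "W = P - (P \<bullet> E) *\<^sub>R E"
  assume "P \<noteq> (P \<bullet> E) *\<^sub>R E"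
  then have "W \<noteq> 0" by (simp add: W_def)
  have EE: "E \<bullet> E = 1" using E by (simp add: dot_square_norm)
  have "W \<bullet> E = 0" by (simp add: W_def inner_diff_left EE)
  then have "P \<bullet> W = W \<bullet> W"
    by (simp add: W_def inner_diff_left inner_diff_right inner_commute)
  moreover have "P \<bullet> sgn W \<le> 0"
    using T \<open>W \<noteq> 0\<close> \<open>W \<bullet> E = 0\<close>
    by (intro le) (auto simp: W_def sgn_div_norm norm_sgn intro!: subspace_scale subspace_diff)
  then have "inverse (norm W) * (P \<bullet> W) \<le> 0"
    by (simp add: sgn_div_norm)
  moreover have "inverse (norm W) > 0" "W \<bullet> W > 0"
    using \<open>W \<noteq> 0\<close> by auto
  ultimately show False
    by (metis mult_pos_pos not_le)
qed

lemma orthonormal_curve_norm: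
  fixes E Z :: "'a::real_inner"
  assumes "norm E = 1" "norm Z = 1" "Z \<bullet> E = 0"
  shows "norm (cos t *\<^sub>R E + sin t *\<^sub>R Z) = 1"
proof -
  have "E \<bullet> E = 1" "Z \<bullet> Z = 1" "E \<bullet> Z = 0"
    using assms by (auto simp: dot_square_norm inner_commute)
  with assms show ?thesis
    by (simp add: norm_eq_1 inner_add_left inner_add_right power2_eq_square [symmetric])
qed

text \<open>The great circle has velocity \<open>Z\<close> at time 0; here it is sampled at times
  \<open>1 / Suc n\<close>. The double reciprocal matches the factor \<open>1 / t n\<close> in the
  eigenvalue lemma.\<close>

lemma orthonormal_curve_derivative:
  fixes E Z :: "'a::real_normed_vector"
  shows "(\<lambda>n. (1 / (1 / real (Suc n))) *\<^sub>R
      (cos (1 / real (Suc n)) *\<^sub>R E + sin (1 / real (Suc n)) *\<^sub>R Z - E)) \<longlonglongrightarrow> Z"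
proof -
  let ?t = "\<lambda>n. 1 / real (Suc n)"
  have t: "filterlim ?t (at 0) sequentially"
    unfolding filterlim_at using LIMSEQ_inverse_real_of_nat by (auto simp: inverse_eq_divide)
  have "((\<lambda>h::real. (cos h - 1) / h) \<longlongrightarrow> 0) (at 0)" "((\<lambda>h::real. sin h / h) \<longlongrightarrow> 1) (at 0)"
    using DERIV_cos [of "0::real"] DERIV_sin [of "0::real"] by (simp_all add: DERIV_def)
  then have "((\<lambda>h. ((cos h - 1) / h) *\<^sub>R E + (sin h / h) *\<^sub>R Z) \<longlongrightarrow> 0 *\<^sub>R E + 1 *\<^sub>R Z) (at 0)"
    by (intro tendsto_intros)
  moreover have "((cos h - 1) / h) *\<^sub>R E + (sin h / h) *\<^sub>R Z
      = (1 / h) *\<^sub>R (cos h *\<^sub>R E + sin h *\<^sub>R Z - E)" for h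
    by (simp add: diff_divide_distrib algebra_simps)
  ultimately have "((\<lambda>h. (1 / h) *\<^sub>R (cos h *\<^sub>R E + sin h *\<^sub>R Z - E)) \<longlongrightarrow> Z) (at 0)"
    by simp
  from filterlim_compose [OF this t] show ?thesis by simp
qed

section \<open>Rank-one matrices and the orthogonal projection\<close>

text \<open>All rows are multiples of \<open>conj_vec y\<close>, so the row space is at most a
  line.\<close>

lemma rank_outer:
  fixes x :: "complex^'m" and y :: "complex^'n"
  assumes "outer x y \<noteq> 0"
  shows "rank (outer x y) = 1"
proof -
  have "rows (outer x y) \<subseteq> vec.span {conj_vec y}"
  proof
    fix r assume "r \<in> rows (outer x y)"
    then obtain i where "r = row i (outer x y)"
      by (auto simp: rows_def)
    then have "r = x $ i *s conj_vec y"
      by (simp add: row_def outer_def conj_vec_def vec_eq_iff)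
    then show "r \<in> vec.span {conj_vec y}"
      by (simp add: vec.span_base vec.span_scale)
  qed
  then have "rank (outer x y) \<le> 1"
    using vec.dim_le_card [of "rows (outer x y)" "{conj_vec y}"] by (simp add: row_rank_def_gen)
  moreover have "rank (outer x y) \<noteq> 0"
  proof
    assume "rank (outer x y) = 0"
    then have "rows (outer x y) \<subseteq> {0}"
      by (simp only: row_rank_def_gen vec.dim_eq_0)
    then have "row i (outer x y) = 0" for i
      by (auto simp: rows_def)
    then have "outer x y = 0"
      by (simp add: row_def vec_eq_iff)
    with assms show False ..
  qed
  ultimately show ?thesis by simp
qed


lemma orth_proj:
  assumes "subspace S"
  shows orth_proj_mem: "orth_proj S Z \<in> S"
    and inner_orth_proj: "W \<in> S \<Longrightarrow> orth_proj S Z \<bullet> W = Z \<bullet> W"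
  using theI' [OF orth_proj_unique_exists [OF assms, of Z]]
  by (auto simp: orth_proj_def Re_frob_inner)

lemma orth_proj_eqI:
  assumes "subspace S" "P \<in> S" "\<And>W. W \<in> S \<Longrightarrow> P \<bullet> W = Z \<bullet> W"
  shows "orth_proj S Z = P"
  unfolding orth_proj_def
  by (rule the1_equality [OF orth_proj_unique_exists]) (use assms in \<open>auto simp: Re_frob_inner\<close>)

text \<open>The scalar is real because \<open>S\<close> may be only real-linear.\<close>

lemma orth_proj_scaleR:
  assumes "subspace S"
  shows "orth_proj S (c *\<^sub>R Z) = c *\<^sub>R orth_proj S Z"
  by (rule orth_proj_eqI [OF assms])
    (simp_all add: assms orth_proj_mem inner_orth_proj subspace_scale)

lemma rank_scaleR_outer:
  fixes x :: "complex^'m" and y :: "complex^'n"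
  assumes "c *\<^sub>R outer x y \<noteq> 0"
  shows "rank (c *\<^sub>R outer x y) = 1"
proof -
  have "c *\<^sub>R outer x y = outer (c *\<^sub>R x) y"
    by (simp add: outer_def vec_eq_iff)
  with assms show ?thesis by (metis rank_outer)
qed

section \<open>Stationarity of the minimizing pair in each component\<close>

theorem corollary3p4:
  fixes A E_star ES_star M_star :: "complex^'n^'n"
    and S :: "(complex^'n^'n) set"
    and lam :: "complex^'n^'n \<Rightarrow> complex"
    and x y :: "complex^'n"
    and \<epsilon> \<delta> :: real
  assumes lam: "\<And>M. rightmost_eigenvalue M (lam M)"
    and "\<epsilon> > 0" and "\<delta> > 0"
    and "subspace S"
    and minimizer:
      "is_arg_min (objective lam A \<epsilon> \<delta>) (\<lambda>p. p \<in> feasible S) (E_star, ES_star)"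
    and M_star: "M_star = perturbed A \<epsilon> \<delta> (E_star, ES_star)"
    and simple: "simple_eigenvalue M_star (lam M_star)"
    and continuous: "\<exists>U. open U \<and> (E_star, ES_star) \<in> U \<and>
      continuous_on (U \<inter> feasible S) (\<lambda>p. lam (perturbed A \<epsilon> \<delta> p))"
    and x: "left_eigenvector M_star (lam M_star) x" "norm x = 1"
    and y: "right_eigenvector M_star (lam M_star) y" "norm y = 1"
    and xy: "cdot x y \<in> \<real>" "Re (cdot x y) > 0"
    and nonzero: "orth_proj S (- outer x y) \<noteq> 0"
  shows "rank E_star = 1 \<and>
    (let \<eta> = 1 / norm (orth_proj S E_star) in
       ES_star = \<eta> *\<^sub>R orth_proj S E_star \<or> ES_star = - (\<eta> *\<^sub>R orth_proj S E_star))"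
proof -
  have star: "(E_star, ES_star) \<in> feasible S"
    using minimizer by (simp add: is_arg_min_def)
  then have E: "norm E_star = 1" and ES: "ES_star \<in> S" "norm ES_star = 1"
    by (auto simp: feasible_def)
  have uniq: "\<exists>c. v = c *s y" if "M_star *v v = lam M_star *s v" for v
    using simple_eigenvalue_eigenvector_unique [OF simple charpoly_nonzero [OF lam] y(1) that] .

  \<comment> \<open>\<open>D\<close> is the velocity with which a feasible sequence leaves the
    minimizer, with step \<open>1 / Suc n\<close>. Continuity of \<open>lam\<close> gives
    convergence of the eigenvalues, minimality the bound on their real parts.\<close>
  have first_order: "outer x y \<bullet> D \<le> 0"
    if feas: "\<And>n. p n \<in> feasible S" and lim: "p \<longlonglongrightarrow> (E_star, ES_star)"
      and D: "(\<lambda>n. (1 / (1 / real (Suc n))) *\<^sub>R (perturbed A \<epsilon> \<delta> (p n) - M_star)) \<longlonglongrightarrow> D"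
    for p D
  proof (rule eigenvalue_directional_derivative_nonpos [where t = "\<lambda>n. 1 / real (Suc n)"])
    show "eigenvalue (perturbed A \<epsilon> \<delta> (p n)) (lam (perturbed A \<epsilon> \<delta> (p n)))" for n
      using lam by (simp add: rightmost_eigenvalue_def)
    obtain U where U: "open U" "(E_star, ES_star) \<in> U"
      "continuous_on (U \<inter> feasible S) (\<lambda>p. lam (perturbed A \<epsilon> \<delta> p))"
      using continuous by blast
    have "eventually (\<lambda>n. p n \<in> U \<inter> feasible S) sequentially"
      using topological_tendstoD [OF lim U(1,2)] feas by (auto elim: eventually_mono)
    then show "(\<lambda>n. lam (perturbed A \<epsilon> \<delta> (p n))) \<longlonglongrightarrow> lam M_star"
      unfolding M_star using U(2) star by (intro continuous_on_tendsto_compose [OF U(3) lim]) auto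
    show "(\<lambda>n. perturbed A \<epsilon> \<delta> (p n)) \<longlonglongrightarrow> M_star"
      unfolding M_star perturbed_def case_prod_beta
      by (intro tendsto_intros tendsto_fst [OF lim] tendsto_snd [OF lim])
    show "Re (lam (perturbed A \<epsilon> \<delta> (p n))) \<le> Re (lam M_star)" for n
    proof -
      have "objective lam A \<epsilon> \<delta> (E_star, ES_star) \<le> objective lam A \<epsilon> \<delta> (p n)"
        using minimizer feas [of n] unfolding is_arg_min_def by (meson not_le)
      then show ?thesis by (simp add: objective_def M_star)
    qed
  qed (use D x xy uniq in auto)

  have curve: "(\<lambda>n. cos (1 / real (Suc n)) *\<^sub>R F + sin (1 / real (Suc n)) *\<^sub>R Z) \<longlonglongrightarrow> F" for F Z :: "complex^'n^'n"
  proof -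
    have "(\<lambda>n. 1 / real (Suc n)) \<longlonglongrightarrow> 0"
      using LIMSEQ_inverse_real_of_nat by (simp add: inverse_eq_divide)
    then have "(\<lambda>n. cos (1 / real (Suc n)) *\<^sub>R F + sin (1 / real (Suc n)) *\<^sub>R Z) \<longlonglongrightarrow> cos 0 *\<^sub>R F + sin 0 *\<^sub>R Z"
      by (intro tendsto_intros)
    then show ?thesis by simp
  qed

  \<comment> \<open>Only the first component moves. It is unstructured, so every direction tangent
    to the unit sphere is allowed.\<close>
  have "outer x y = (outer x y \<bullet> E_star) *\<^sub>R E_star"
  proof (rule sphere_stationary [where T = UNIV])
    fix Z assume Z: "norm Z = 1" "Z \<bullet> E_star = 0"
    let ?c = "\<lambda>n. cos (1 / real (Suc n)) *\<^sub>R E_star + sin (1 / real (Suc n)) *\<^sub>R Z"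
    have "outer x y \<bullet> (\<epsilon> *\<^sub>R Z) \<le> 0"
    proof (rule first_order [where p = "\<lambda>n. (?c n, ES_star)"])
      show "(?c n, ES_star) \<in> feasible S" for n
        using ES orthonormal_curve_norm [OF E Z] by (simp add: feasible_def)
      show "(\<lambda>n. (?c n, ES_star)) \<longlonglongrightarrow> (E_star, ES_star)"
        by (intro tendsto_Pair curve tendsto_const)
      show "(\<lambda>n. (1 / (1 / real (Suc n))) *\<^sub>R (perturbed A \<epsilon> \<delta> (?c n, ES_star) - M_star)) \<longlonglongrightarrow> \<epsilon> *\<^sub>R Z"
        using tendsto_scaleR [OF tendsto_const [of \<epsilon>] orthonormal_curve_derivative [of E_star Z]]
        by (simp add: perturbed_def M_star algebra_simps)
    qed
    then show "outer x y \<bullet> Z \<le> 0"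
      using \<open>\<epsilon> > 0\<close> by (simp add: mult_le_0_iff)
  qed (use E in auto)
  then obtain a where a: "outer x y = a *\<^sub>R E_star" by blast

  let ?P = "orth_proj S (outer x y)"
  \<comment> \<open>Now only the second component moves, on a circle inside \<open>S\<close>.
    Against directions in \<open>S\<close>, \<open>outer x y\<close> and its projection
    \<open>?P\<close> have the same inner product.\<close>
  have "?P = (?P \<bullet> ES_star) *\<^sub>R ES_star"
  proof (rule sphere_stationary [OF \<open>subspace S\<close> ES(1) orth_proj_mem ES(2)])
    fix Z assume ZS: "Z \<in> S" and Z: "norm Z = 1" "Z \<bullet> ES_star = 0"
    let ?c = "\<lambda>n. cos (1 / real (Suc n)) *\<^sub>R ES_star + sin (1 / real (Suc n)) *\<^sub>R Z"
    have "outer x y \<bullet> (\<delta> *\<^sub>R Z) \<le> 0"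
    proof (rule first_order [where p = "\<lambda>n. (E_star, ?c n)"])
      show "(E_star, ?c n) \<in> feasible S" for n
        using E orthonormal_curve_norm [OF ES(2) Z] \<open>subspace S\<close> ES(1) ZS
        by (simp add: feasible_def subspace_add subspace_scale)
      show "(\<lambda>n. (E_star, ?c n)) \<longlonglongrightarrow> (E_star, ES_star)"
        by (intro tendsto_Pair curve tendsto_const)
      show "(\<lambda>n. (1 / (1 / real (Suc n))) *\<^sub>R (perturbed A \<epsilon> \<delta> (E_star, ?c n) - M_star)) \<longlonglongrightarrow> \<delta> *\<^sub>R Z"
        using tendsto_scaleR [OF tendsto_const [of \<delta>] orthonormal_curve_derivative [of ES_star Z]]
        by (simp add: perturbed_def M_star algebra_simps)
    qed
    then show "?P \<bullet> Z \<le> 0"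
      using \<open>\<delta> > 0\<close> ZS by (simp add: inner_orth_proj \<open>subspace S\<close> mult_le_0_iff)
  qed (fact \<open>subspace S\<close>)
  then obtain b where b: "?P = b *\<^sub>R ES_star" by blast

  have P: "?P = a *\<^sub>R orth_proj S E_star"
    by (simp add: a orth_proj_scaleR \<open>subspace S\<close>)
  have "?P \<noteq> 0"
    using nonzero orth_proj_scaleR [OF \<open>subspace S\<close>, of "-1" "outer x y"] by auto
  with P b have "a \<noteq> 0" "b \<noteq> 0" by auto
  have "E_star = (1 / a) *\<^sub>R outer x y"
    using \<open>a \<noteq> 0\<close> by (simp add: a)
  then have rank: "rank E_star = 1"
    using rank_scaleR_outer [of "1 / a" x y] E by (metis norm_zero zero_neq_one)
  \<comment> \<open>The two stationarity conditions give \<open>?P\<close> as \<open>a\<close> times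
    the projection of \<open>E_star\<close> and as \<open>b\<close> times \<open>ES_star\<close>;
    \<open>k\<close> is the resulting ratio.\<close>
  define k where "k = b / a"
  have proj: "orth_proj S E_star = k *\<^sub>R ES_star"
    using P b \<open>a \<noteq> 0\<close> by (metis (no_types, lifting) k_def divide_inverse_commute scaleR_scaleR scaleR_one left_inverse)
  have "k \<noteq> 0"
    using \<open>a \<noteq> 0\<close> \<open>b \<noteq> 0\<close> by (simp add: k_def)
  \<comment> \<open>Normalizing \<open>k *\<^sub>R ES_star\<close> leaves only the sign of
    \<open>k\<close>, which decides between the two alternatives.\<close>
  then have "ES_star = (1 / norm (k *\<^sub>R ES_star)) *\<^sub>R k *\<^sub>R ES_star \<or>
      ES_star = - ((1 / norm (k *\<^sub>R ES_star)) *\<^sub>R k *\<^sub>R ES_star)"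
    using ES(2) by (cases "k > 0") simp_all
  with rank show ?thesis
    by (simp add: proj Let_def)
qed

end
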